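(* Let $M$ be either the upper half plane $\mathbb{H}^2$ or the Poincaré disk $\mathbb{D}$, with hyperbolic metric $\mathbf{g}_M$. A smooth vector field $\xi$ on $M$ is harmonic if and only if the quadratic differential $(\mathcal{L}_\xi \mathbf{g}_M)^{(2,0)}$ is holomorphic.
   Context: $\mathbb{H}^2=\{x+iy\in\mathbb{C}: y>0\}$ carries the metric $\mathbf{g}_{\mathbb{H}^2}=(dx^2+dy^2)/y^2$, and $\mathbb{D}=\{|z|<1\}$ carries $\mathbf{g}_{\mathbb{D}}=4(dx^2+dy^2)/(1-|z|^2)^2$. Harmonic vector field: for a smooth map $\phi:U\to M$ from an open set $U\subseteq M$, the tension field is $\tau(\phi)=\mathrm{trace}(\nabla d\phi)$, where $\nabla$ is the connection on $T^*U\otimes\phi^{-1}TM$ induced by the Levi-Civita connections. A smooth vector field $\xi$ on $U$ is harmonic if there is a smooth family of smooth maps $\phi_t:U\to M$, $t\in[0,\epsilon)$, such that $\phi_0$ is the inclusion, $\frac{d\phi_t}{dt}|_{t=0}=\xi$, and $\frac{d}{dt}|_{t=0}\tau(\phi_t)(x)=0$ for all $x\in U$ (computed in the standard coordinates of $\mathbb{C}$). $(2,0)$-part: $\mathcal{L}_\xi\mathbf{g}_M$ is the Lie derivative of the metric, a real symmetric bilinear form on $TM$. Its trace-free part can be written uniquely as the real part of $f\,dz^2$ with $f$ a complex-valued function ($dz^2=dz\otimes dz$), and $(\mathcal{L}_\xi\mathbf{g}_M)^{(2,0)}:=f\,dz^2$. It is called holomorphic if $f$ is holomorphic. *)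

theory Defs
  imports "HOL-Analysis.Analysis"
begin

section \<open>Smooth maps\<close>

primrec higher_differentiable_on ::
  "'a::real_normed_vector set \<Rightarrow> ('a \<Rightarrow> 'b::real_normed_vector) \<Rightarrow> nat \<Rightarrow> bool" where
  "higher_differentiable_on S f 0 \<longleftrightarrow> continuous_on S f"
| "higher_differentiable_on S f (Suc n) \<longleftrightarrow>
     (\<forall>x\<in>S. f differentiable (at x)) \<and>
     (\<forall>v. higher_differentiable_on S (\<lambda>x. frechet_derivative f (at x) v) n)"

text \<open>
  Smoothness on an arbitrary set means having smooth local extensions to open sets. For an open
  set this is ordinary smoothness; the general form is needed for families parametrised by the
  half-open interval \<open>[0, \<epsilon>)\<close>.
\<close>

definition smooth_on ::
  "'a::real_normed_vector set \<Rightarrow> ('a \<Rightarrow> 'b::real_normed_vector) \<Rightarrow> bool" where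
  "smooth_on S f \<longleftrightarrow>
     (\<forall>p\<in>S. \<exists>W F. open W \<and> p \<in> W \<and> (\<forall>n. higher_differentiable_on W F n) \<and>
        (\<forall>x \<in> W \<inter> S. F x = f x))"


section \<open>Metrics on open subsets of the plane\<close>

text \<open>
  Every tangent space of an open subset of the plane is identified with \<^typ>\<open>complex\<close>, regarded
  as a real vector space, and vector fields with functions \<^typ>\<open>complex \<Rightarrow> complex\<close>. A field of
  bilinear forms takes a base point and two tangent vectors.
\<close>

type_synonym metric = "complex \<Rightarrow> complex \<Rightarrow> complex \<Rightarrow> real"

definition upper_half_plane :: "complex set" where
  "upper_half_plane = {z. 0 < Im z}"

definition upper_half_plane_metric :: metric where
  "upper_half_plane_metric z u v = (u \<bullet> v) / (Im z)\<^sup>2"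

definition unit_disk :: "complex set" where
  "unit_disk = {z. cmod z < 1}"

definition unit_disk_metric :: metric where
  "unit_disk_metric z u v = 4 * (u \<bullet> v) / (1 - (cmod z)\<^sup>2)\<^sup>2"

text \<open>
  The Levi-Civita connection at a point, as a Christoffel form:
  \<open>\<nabla>\<^sub>u Y = D\<^sub>u Y + \<Gamma>(u, Y)\<close>. Symmetry says that it is torsion-free, the
  last conjunct (for constant fields \<open>v\<close> and \<open>w\<close>) that it is compatible with the metric.
\<close>

definition is_levi_civita :: "metric \<Rightarrow> complex \<Rightarrow> (complex \<Rightarrow> complex \<Rightarrow> complex) \<Rightarrow> bool" where
  "is_levi_civita g z \<Gamma> \<longleftrightarrow>
     bilinear \<Gamma> \<and> (\<forall>u v. \<Gamma> u v = \<Gamma> v u) \<and>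
     (\<forall>u v w. frechet_derivative (\<lambda>x. g x v w) (at z) u = g z (\<Gamma> u v) w + g z v (\<Gamma> u w))"

definition christoffel :: "metric \<Rightarrow> complex \<Rightarrow> complex \<Rightarrow> complex \<Rightarrow> complex" where
  "christoffel g z = (THE \<Gamma>. is_levi_civita g z \<Gamma>)"

definition orthonormal_frame :: "metric \<Rightarrow> complex \<Rightarrow> complex \<Rightarrow> complex \<Rightarrow> bool" where
  "orthonormal_frame g z a b \<longleftrightarrow> g z a a = 1 \<and> g z b b = 1 \<and> g z a b = 0"

definition metric_trace ::
  "metric \<Rightarrow> complex \<Rightarrow> (complex \<Rightarrow> complex \<Rightarrow> 'a::real_vector) \<Rightarrow> 'a" where
  "metric_trace g z B = (THE c. \<forall>a b. orthonormal_frame g z a b \<longrightarrow> c = B a a + B b b)"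


section \<open>Tension field and harmonic vector fields\<close>

text \<open>
  The connection induced on \<open>\<phi>\<^sup>-\<^sup>1TM\<close>, differentiating a section \<open>s\<close> along \<open>\<phi>\<close>
  at the point \<open>x\<close> in the direction \<open>u\<close>.
\<close>

definition pullback_connection ::
  "metric \<Rightarrow> (complex \<Rightarrow> complex) \<Rightarrow> (complex \<Rightarrow> complex) \<Rightarrow> complex \<Rightarrow> complex \<Rightarrow> complex" where
  "pullback_connection g \<phi> s x u =
     frechet_derivative s (at x) u
       + christoffel g (\<phi> x) (frechet_derivative \<phi> (at x) u) (s x)"

text \<open>
  \<open>(\<nabla>\<^sub>u d\<phi>)(v) = \<nabla>\<^sub>u(d\<phi>(v)) - d\<phi>(\<nabla>\<^sub>u v)\<close>, where \<open>v\<close> is extended as a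
  constant field, so that \<open>\<nabla>\<^sub>u v\<close> is the Christoffel term alone.
\<close>

definition nabla_differential ::
  "metric \<Rightarrow> (complex \<Rightarrow> complex) \<Rightarrow> complex \<Rightarrow> complex \<Rightarrow> complex \<Rightarrow> complex" where
  "nabla_differential g \<phi> x u v =
     pullback_connection g \<phi> (\<lambda>y. frechet_derivative \<phi> (at y) v) x u
       - frechet_derivative \<phi> (at x) (christoffel g x u v)"

definition tension_field :: "metric \<Rightarrow> (complex \<Rightarrow> complex) \<Rightarrow> complex \<Rightarrow> complex" where
  "tension_field g \<phi> x = metric_trace g x (nabla_differential g \<phi> x)"

definition harmonic_vector_field ::
  "complex set \<Rightarrow> metric \<Rightarrow> complex set \<Rightarrow> (complex \<Rightarrow> complex) \<Rightarrow> bool" where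
  "harmonic_vector_field M g U \<xi> \<longleftrightarrow>
     open U \<and> U \<subseteq> M \<and> smooth_on U \<xi> \<and>
     (\<exists>\<epsilon>>0. \<exists>\<phi> :: real \<Rightarrow> complex \<Rightarrow> complex.
        smooth_on ({0..<\<epsilon>} \<times> U) (\<lambda>(t, x). \<phi> t x) \<and>
        (\<forall>t\<in>{0..<\<epsilon>}. \<forall>x\<in>U. \<phi> t x \<in> M) \<and>
        (\<forall>x\<in>U. \<phi> 0 x = x) \<and>
        (\<forall>x\<in>U. ((\<lambda>t. \<phi> t x) has_vector_derivative \<xi> x) (at 0 within {0..<\<epsilon>})) \<and>
        (\<forall>x\<in>U. ((\<lambda>t. tension_field g (\<phi> t) x) has_vector_derivative 0) (at 0 within {0..<\<epsilon>})))"


section \<open>Lie derivative of the metric and its (2,0)-part\<close>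

definition lie_bracket ::
  "(complex \<Rightarrow> complex) \<Rightarrow> (complex \<Rightarrow> complex) \<Rightarrow> complex \<Rightarrow> complex" where
  "lie_bracket X Y z =
     frechet_derivative Y (at z) (X z) - frechet_derivative X (at z) (Y z)"

text \<open>
  \<open>(\<L>\<^sub>\<xi> g)(X, Y) = \<xi>(g(X, Y)) - g([\<xi>, X], Y) - g(X, [\<xi>, Y])\<close>, evaluated on the
  constant fields \<open>u\<close> and \<open>v\<close>.
\<close>

definition lie_derivative_metric :: "(complex \<Rightarrow> complex) \<Rightarrow> metric \<Rightarrow> metric" where
  "lie_derivative_metric \<xi> g z u v =
     frechet_derivative (\<lambda>x. g x u v) (at z) (\<xi> z)
       - g z (lie_bracket \<xi> (\<lambda>_. u) z) v - g z u (lie_bracket \<xi> (\<lambda>_. v) z)"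

definition trace_free_part :: "metric \<Rightarrow> metric \<Rightarrow> metric" where
  "trace_free_part g h z u v = h z u v - metric_trace g z (h z) / 2 * g z u v"

text \<open>
  The coefficient \<open>f\<close> of \<open>f dz\<^sup>2\<close>; here \<open>dz\<^sup>2(u, v) = u v\<close> (complex product).
\<close>

definition part20 :: "metric \<Rightarrow> metric \<Rightarrow> complex \<Rightarrow> complex" where
  "part20 g h z = (THE c. \<forall>u v. trace_free_part g h z u v = Re (c * (u * v)))"


section \<open>Well-definedness for conformal metrics\<close>

lemma bilinear_complex_expand:
  fixes B :: "complex \<Rightarrow> complex \<Rightarrow> 'a::real_vector"
  assumes "bilinear B"
  shows "B u v = (Re u * Re v) *\<^sub>R B 1 1 + (Re u * Im v) *\<^sub>R B 1 \<i>
     + (Im u * Re v) *\<^sub>R B \<i> 1 + (Im u * Im v) *\<^sub>R B \<i> \<i>"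
proof -
  have d: "x = Re x *\<^sub>R 1 + Im x *\<^sub>R \<i>" for x
    by (simp add: complex_eq_iff)
  have "B u v = B (Re u *\<^sub>R 1 + Im u *\<^sub>R \<i>) (Re v *\<^sub>R 1 + Im v *\<^sub>R \<i>)"
    using d[of u] d[of v] by simp
  also have "\<dots> = (Re u * Re v) *\<^sub>R B 1 1 + (Re u * Im v) *\<^sub>R B 1 \<i>
     + (Im u * Re v) *\<^sub>R B \<i> 1 + (Im u * Im v) *\<^sub>R B \<i> \<i>"
    unfolding bilinear_ladd[OF assms] bilinear_radd[OF assms]
      bilinear_lmul[OF assms] bilinear_rmul[OF assms]
    by (simp add: algebra_simps)
  finally show ?thesis .
qed

lemma ex1_levi_civita_conformal:
  fixes \<rho> :: "complex \<Rightarrow> real"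
  assumes g: "\<And>x u v. g x u v = \<rho> x * (u \<bullet> v)"
    and diff: "\<rho> differentiable (at z)" and pos: "\<rho> z > 0"
  shows "\<exists>!\<Gamma>. is_levi_civita g z \<Gamma>"
proof (rule ex_ex1I)
  define d where "d = frechet_derivative \<rho> (at z)"
  have hd: "(\<rho> has_derivative d) (at z)"
    using diff unfolding d_def by (simp add: frechet_derivative_works)
  have lin: "linear d" using hd has_derivative_linear by blast
  define G where "G = Complex (d 1) (d \<i>)"
  have dG: "d w = G \<bullet> w" for w
  proof -
    have "d w = d (Re w *\<^sub>R 1 + Im w *\<^sub>R \<i>)"
      by (rule arg_cong[where f = d]) (simp add: complex_eq_iff)
    then show ?thesis
      by (simp only: linear_add[OF lin] linear_cmul[OF lin])
        (simp add: G_def inner_complex_def algebra_simps)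
  qed
  have fd: "frechet_derivative (\<lambda>x. g x v w) (at z) u = (G \<bullet> u) * (v \<bullet> w)" for u v w
  proof -
    have "((\<lambda>x. g x v w) has_derivative (\<lambda>u. d u * (v \<bullet> w))) (at z)"
      unfolding g by (rule has_derivative_mult_left[OF hd])
    then show ?thesis
      using frechet_derivative_at dG by metis
  qed
  define \<Gamma> where "\<Gamma> u v =
    (1 / (2 * \<rho> z)) *\<^sub>R ((G \<bullet> u) *\<^sub>R v + (G \<bullet> v) *\<^sub>R u - (u \<bullet> v) *\<^sub>R G)" for u v
  have "bilinear \<Gamma>"
    unfolding bilinear_def \<Gamma>_def
    by (auto intro!: linearI simp: inner_add_right inner_add_left add_divide_distrib algebra_simps)
  moreover have "\<Gamma> u v = \<Gamma> v u" for u v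
    by (simp add: \<Gamma>_def inner_commute algebra_simps)
  moreover have "(G \<bullet> u) * (v \<bullet> w) = g z (\<Gamma> u v) w + g z v (\<Gamma> u w)" for u v w
    using pos unfolding g \<Gamma>_def
    by (simp add: inner_diff_left inner_diff_right inner_add_left inner_add_right
        inner_commute field_simps)
  ultimately show "\<exists>\<Gamma>. is_levi_civita g z \<Gamma>"
    unfolding is_levi_civita_def fd by blast
next
  fix \<Gamma> \<Delta>
  assume L: "is_levi_civita g z \<Gamma>" "is_levi_civita g z \<Delta>"
  define A where "A u v w = (\<Gamma> u v - \<Delta> u v) \<bullet> w" for u v w
  have sym: "A u v w = A v u w" for u v w
    using L unfolding is_levi_civita_def A_def by metis
  have skew: "A u v w = - A u w v" for u v w
  proof -
    have "g z (\<Gamma> u v) w + g z v (\<Gamma> u w) = g z (\<Delta> u v) w + g z v (\<Delta> u w)"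
      using L unfolding is_levi_civita_def by metis
    then have "\<rho> z * (A u v w + A u w v) = 0"
      unfolding g A_def by (simp add: inner_diff_left inner_commute algebra_simps)
    then show ?thesis using pos by simp
  qed
  have "A u v w = 0" for u v w
    using sym[of u v w] skew[of v u w] sym[of v w u] skew[of w v u] sym[of w u v] skew[of u w v]
    by linarith
  then have "\<Gamma> u v - \<Delta> u v = 0" for u v
    unfolding A_def by (metis inner_eq_zero_iff)
  then show "\<Gamma> = \<Delta>" by (simp add: fun_eq_iff)
qed

lemma orthogonal_pair_real:
  fixes p q x y s :: real
  assumes "p\<^sup>2 + q\<^sup>2 = s" "x\<^sup>2 + y\<^sup>2 = s" "p * x + q * y = 0" "s > 0"
  shows "p * p + x * x = s" "q * q + y * y = s" "p * q + x * y = 0"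
proof -
  define k where "k = (p * y - q * x) / s"
  have "s * x = p * (p * x + q * y) - (p * y - q * x) * q"
    "s * y = q * (p * x + q * y) + (p * y - q * x) * p"
    unfolding assms(1)[symmetric] by (simp_all add: power2_eq_square algebra_simps)
  then have x: "x = - k * q" and y: "y = k * p"
    using assms(3,4) by (simp_all add: k_def field_simps)
  have "x\<^sup>2 + y\<^sup>2 = k\<^sup>2 * (p\<^sup>2 + q\<^sup>2)"
    unfolding x y by (simp add: power2_eq_square algebra_simps)
  then have k: "k * k = 1" using assms by (simp add: power2_eq_square)
  have "x * x = (k * k) * (q * q)" "y * y = (k * k) * (p * p)" "x * y = - (k * k) * (p * q)"
    unfolding x y by (simp_all add: algebra_simps)
  then show "p * p + x * x = s" "q * q + y * y = s" "p * q + x * y = 0"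
    using assms(1) by (simp_all add: k power2_eq_square algebra_simps)
qed

lemma metric_trace_conformal:
  fixes B :: "complex \<Rightarrow> complex \<Rightarrow> 'a::real_vector"
  assumes g: "\<And>u v. g z u v = r * (u \<bullet> v)" and pos: "r > 0" and B: "bilinear B"
  shows "metric_trace g z B = (1 / r) *\<^sub>R (B 1 1 + B \<i> \<i>)"
  unfolding metric_trace_def
proof (rule the_equality)
  have "B a a + B b b = (1 / r) *\<^sub>R (B 1 1 + B \<i> \<i>)" if "orthonormal_frame g z a b" for a b
  proof -
    have 1: "(Re a)\<^sup>2 + (Im a)\<^sup>2 = 1 / r" "(Re b)\<^sup>2 + (Im b)\<^sup>2 = 1 / r"
      and "r * (Re a * Re b + Im a * Im b) = 0"
      using that pos unfolding orthonormal_frame_def g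
      by (auto simp: inner_complex_def power2_eq_square field_simps)
    then have 2: "Re a * Re b + Im a * Im b = 0" using pos by simp
    define s where "s = 1 / r"
    have s: "s > 0" using pos by (simp add: s_def)
    note 1 = 1[folded s_def]
    note e = orthogonal_pair_real[OF 1 2 s]
    have "B a a + B b b =
       (Re a * Re a + Re b * Re b) *\<^sub>R B 1 1 + (Re a * Im a + Re b * Im b) *\<^sub>R B 1 \<i>
       + (Re a * Im a + Re b * Im b) *\<^sub>R B \<i> 1 + (Im a * Im a + Im b * Im b) *\<^sub>R B \<i> \<i>"
      unfolding bilinear_complex_expand[OF B, of a a] bilinear_complex_expand[OF B, of b b]
      by (simp add: algebra_simps)
    then show ?thesis unfolding e s_def[symmetric] by (simp add: scaleR_add_right)
  qed
  then show *: "\<forall>a b. orthonormal_frame g z a b \<longrightarrow> (1 / r) *\<^sub>R (B 1 1 + B \<i> \<i>) = B a a + B b b"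
    by simp
  fix c assume c: "\<forall>a b. orthonormal_frame g z a b \<longrightarrow> c = B a a + B b b"
  have "orthonormal_frame g z (Complex (1 / sqrt r) 0) (Complex 0 (1 / sqrt r))"
    using pos by (simp add: orthonormal_frame_def g inner_complex_def)
  then show "c = (1 / r) *\<^sub>R (B 1 1 + B \<i> \<i>)" using * c by metis
qed

lemma ex1_part20_conformal:
  assumes g: "\<And>u v. g z u v = r * (u \<bullet> v)" and pos: "r > 0"
    and B: "bilinear (h z)" and sym: "\<And>u v. h z u v = h z v u"
  shows "\<exists>!c. \<forall>u v. trace_free_part g h z u v = Re (c * (u * v))"
proof (rule ex_ex1I)
  define c where "c = Complex ((h z 1 1 - h z \<i> \<i>) / 2) (- h z 1 \<i>)"
  have "trace_free_part g h z u v = Re (c * (u * v))" for u v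
    unfolding trace_free_part_def metric_trace_conformal[of g z r "h z", OF g pos B] g c_def
      bilinear_complex_expand[OF B, of u v] sym[of \<i> 1]
    using pos by (simp add: inner_complex_def field_simps)
  then show "\<exists>c. \<forall>u v. trace_free_part g h z u v = Re (c * (u * v))" by blast
next
  fix c d
  assume "\<forall>u v. trace_free_part g h z u v = Re (c * (u * v))"
    "\<forall>u v. trace_free_part g h z u v = Re (d * (u * v))"
  then have "Re (c * (u * v)) = Re (d * (u * v))" for u v by simp
  from this[of 1 1] this[of 1 \<i>] show "c = d" by (simp add: complex_eq_iff)
qed

end

theory Submission
  imports Defs
begin

text \<open>
  Both metrics are conformal, \<open>\<rho>(z) (u \<bullet> v)\<close>, and in complex notation the Levi-Civita connection is
  multiplication by \<open>L = \<partial>\<^sub>z log \<rho>\<close>, so that \<open>\<tau>(\<phi>) = (\<Delta>\<phi> + L(\<phi>) (\<phi>\<^sub>x\<^sup>2 + \<phi>\<^sub>y\<^sup>2)) / \<rho>\<close>.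
  For the identity \<open>\<phi>\<^sub>x\<^sup>2 + \<phi>\<^sub>y\<^sup>2 = 1 + \<i>\<^sup>2 = 0\<close>, so the derivative of \<open>L\<close> drops out of the linearisation,
  which becomes \<open>J(\<xi>) / \<rho>\<close> with \<open>J(\<xi>) = \<Delta>\<xi> + 2 L B\<close> and \<open>B = \<xi>\<^sub>x + \<i> \<xi>\<^sub>y\<close>. The (2,0)-part of the Lie
  derivative has coefficient \<open>\<rho> cnj B\<close>, and the Cauchy-Riemann equation for it is the conjugate of
  \<open>(\<rho> B)\<^sub>x - \<i> (\<rho> B)\<^sub>y = \<rho> J(\<xi>) = 0\<close>. Conversely, a variation realising a given \<open>\<xi>\<close> exists because
  the Euclidean translate of a point by a vector of \<open>g\<close>-length less than 1 stays in \<open>M\<close>.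
\<close>

section \<open>Smooth maps and symmetry of second derivatives\<close>

text \<open>The direction comes first so that \<open>dir_deriv v\<close> is an operator on
  functions, ready to be iterated.\<close>

abbreviation dir_deriv ::
  "'a::real_normed_vector \<Rightarrow> ('a \<Rightarrow> 'b::real_normed_vector) \<Rightarrow> 'a \<Rightarrow> 'b" where
  "dir_deriv v f \<equiv> (\<lambda>x. frechet_derivative f (at x) v)"

lemma dir_derivI: "(f has_derivative D) (at x) \<Longrightarrow> dir_deriv v f x = D v"
  by (metis frechet_derivative_at)

lemma has_derivative_dir_deriv:
  "f differentiable (at x) \<Longrightarrow> (f has_derivative (\<lambda>v. dir_deriv v f x)) (at x)"
  using frechet_derivative_works by blast

section \<open>Locality of higher differentiability\<close>

lemma higher_differentiable_on_subset:
  "higher_differentiable_on S f n \<Longrightarrow> T \<subseteq> S \<Longrightarrow> higher_differentiable_on T f n"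
  by (induction n arbitrary: f) (auto intro: continuous_on_subset)

lemma higher_differentiable_on_SucD:
  "higher_differentiable_on S f (Suc n) \<Longrightarrow> higher_differentiable_on S f n"
proof (induction n arbitrary: f)
  case 0
  then show ?case
    by (auto intro!: continuous_at_imp_continuous_on differentiable_imp_continuous_within)
qed auto

lemma dir_deriv_cong:
  assumes "open S" "x \<in> S" "\<And>y. y \<in> S \<Longrightarrow> f y = g y"
  shows "dir_deriv v f x = dir_deriv v g x"
proof -
  have "(f has_derivative f') (at x) \<longleftrightarrow> (g has_derivative f') (at x)" for f'
    using assms has_derivative_transform_within_open[of f f' x UNIV S g]
      has_derivative_transform_within_open[of g f' x UNIV S f] by auto
  then show ?thesis by (simp add: frechet_derivative_def)
qed

lemma differentiable_cong_open:
  assumes "open S" "x \<in> S" "\<And>y. y \<in> S \<Longrightarrow> f y = g y"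
  shows "f differentiable (at x) \<longleftrightarrow> g differentiable (at x)"
  using assms has_derivative_transform_within_open[of f _ x UNIV S g]
      has_derivative_transform_within_open[of g _ x UNIV S f]
  unfolding differentiable_def by auto

lemma higher_differentiable_on_cong:
  assumes "open S" "\<And>x. x \<in> S \<Longrightarrow> f x = g x"
  shows "higher_differentiable_on S f n \<longleftrightarrow> higher_differentiable_on S g n"
  using assms(2)
proof (induction n arbitrary: f g)
  case 0
  then show ?case by (simp cong: continuous_on_cong)
next
  case (Suc n)
  have "higher_differentiable_on S (dir_deriv v f) n \<longleftrightarrow> higher_differentiable_on S (dir_deriv v g) n" for v
    by (rule Suc.IH) (rule dir_deriv_cong[OF assms(1)], use Suc.prems in auto)
  moreover have "f differentiable (at x) \<longleftrightarrow> g differentiable (at x)" if "x \<in> S" for x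
    using differentiable_cong_open[OF assms(1) that] Suc.prems by blast
  ultimately show ?case by simp
qed

text \<open>Differentiability at a point and the derivative there are already determined on any
  neighbourhood. This glues the local extensions that \<open>smooth_on\<close> provides.\<close>

lemma higher_differentiable_on_local:
  assumes "\<And>x. x \<in> S \<Longrightarrow> \<exists>T. open T \<and> x \<in> T \<and> higher_differentiable_on T f n"
  shows "higher_differentiable_on S f n"
  using assms
proof (induction n arbitrary: f)
  case 0
  show ?case
    unfolding higher_differentiable_on.simps
  proof (rule continuous_at_imp_continuous_on, rule ballI)
    fix x assume "x \<in> S"
    from 0[OF this] obtain T where "open T" "x \<in> T" "continuous_on T f" by auto
    then show "isCont f x" using continuous_on_eq_continuous_at by blast
  qed
next
  case (Suc n)
  have "higher_differentiable_on S (dir_deriv v f) n" for v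
  proof (rule Suc.IH)
    fix x assume "x \<in> S"
    from Suc.prems[OF this]
    show "\<exists>T. open T \<and> x \<in> T \<and> higher_differentiable_on T (dir_deriv v f) n"
      by auto
  qed
  moreover have "f differentiable (at x)" if "x \<in> S" for x
    using Suc.prems[OF that] by auto
  ultimately show ?case by simp
qed

section \<open>Closure of higher differentiability under algebraic operations and affine
  substitution\<close>

lemma higher_differentiable_on_const [simp]: "higher_differentiable_on S (\<lambda>x. c) n"
  by (induction n arbitrary: c) auto

lemma higher_differentiable_on_bounded_linear:
  assumes "bounded_linear f"
  shows "higher_differentiable_on S f n"
proof (cases n)
  case 0
  then show ?thesis
    using assms by (simp add: linear_continuous_on)
next
  case (Suc m)
  have "(f has_derivative f) (at x)" for x
    by (rule bounded_linear_imp_has_derivative[OF assms])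
  then have "dir_deriv v f = (\<lambda>x. f v)" "f differentiable (at x)" for v x
    by (auto simp: fun_eq_iff differentiable_def intro!: dir_derivI)
  then show ?thesis using Suc by simp
qed

lemma higher_differentiable_on_add:
  assumes "open S" "higher_differentiable_on S f n" "higher_differentiable_on S g n"
  shows "higher_differentiable_on S (\<lambda>x. f x + g x) n"
  using assms(2,3)
proof (induction n arbitrary: f g)
  case 0
  then show ?case by (simp add: continuous_on_add)
next
  case (Suc n)
  have "higher_differentiable_on S (dir_deriv v (\<lambda>x. f x + g x)) n" for v
  proof (subst higher_differentiable_on_cong[OF assms(1)])
    show "higher_differentiable_on S (\<lambda>x. dir_deriv v f x + dir_deriv v g x) n"
      using Suc by auto
    fix x assume "x \<in> S"
    then have "f differentiable (at x)" "g differentiable (at x)" using Suc.prems by auto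
    then show "dir_deriv v (\<lambda>x. f x + g x) x = dir_deriv v f x + dir_deriv v g x"
      by (intro dir_derivI has_derivative_add has_derivative_dir_deriv)
  qed
  then show ?case using Suc.prems by auto
qed

text \<open>By the product rule the derivative is a sum of two terms of the same shape, so the
  induction closes. A general \<open>B\<close> covers products, scalar multiples and inner products
  at once.\<close>

lemma higher_differentiable_on_bilinear:
  assumes "bounded_bilinear B" "open S"
    and "higher_differentiable_on S f n" "higher_differentiable_on S g n"
  shows "higher_differentiable_on S (\<lambda>x. B (f x) (g x)) n"
  using assms(3,4)
proof (induction n arbitrary: f g)
  case 0
  then show ?case by (simp add: bounded_bilinear.continuous_on[OF assms(1)])
next
  case (Suc n)
  have der: "((\<lambda>x. B (f x) (g x)) has_derivative
      (\<lambda>v. B (f x) (dir_deriv v g x) + B (dir_deriv v f x) (g x))) (at x)" if "x \<in> S" for x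
    using Suc.prems that
    by (intro bounded_bilinear.FDERIV[OF assms(1)]) (auto intro: has_derivative_dir_deriv)
  have "higher_differentiable_on S (dir_deriv v (\<lambda>x. B (f x) (g x))) n" for v
  proof (subst higher_differentiable_on_cong[OF assms(2)])
    show "higher_differentiable_on S
        (\<lambda>x. B (f x) (dir_deriv v g x) + B (dir_deriv v f x) (g x)) n"
      using Suc.prems higher_differentiable_on_SucD[OF Suc.prems(1)]
        higher_differentiable_on_SucD[OF Suc.prems(2)]
      by (intro higher_differentiable_on_add assms(2) Suc.IH) auto
    show "dir_deriv v (\<lambda>x. B (f x) (g x)) x = B (f x) (dir_deriv v g x) + B (dir_deriv v f x) (g x)"
      if "x \<in> S" for x
      by (rule dir_derivI[OF der[OF that]])
  qed
  then show ?case using der by (auto simp: differentiable_def)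
qed

lemmas higher_differentiable_on_mult =
    higher_differentiable_on_bilinear[OF bounded_bilinear_mult]
  and higher_differentiable_on_scaleR =
    higher_differentiable_on_bilinear[OF bounded_bilinear_scaleR]
  and higher_differentiable_on_inner =
    higher_differentiable_on_bilinear[OF bounded_bilinear_inner]

lemma higher_differentiable_on_inverse:
  fixes f :: "'a::real_normed_vector \<Rightarrow> 'b::real_normed_field"
  assumes "open S" "\<And>x. x \<in> S \<Longrightarrow> f x \<noteq> 0" "higher_differentiable_on S f n"
  shows "higher_differentiable_on S (\<lambda>x. inverse (f x)) n"
  using assms(3)
proof (induction n)
  case 0
  then show ?case using assms(2) by (simp add: continuous_on_inverse)
next
  case (Suc n)
  have der: "((\<lambda>x. inverse (f x)) has_derivative
      (\<lambda>v. - (inverse (f x) * dir_deriv v f x * inverse (f x)))) (at x)" if "x \<in> S" for x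
    using Suc.prems that assms(2)
    by (intro Deriv.has_derivative_inverse) (auto intro: has_derivative_dir_deriv)
  have "higher_differentiable_on S (dir_deriv v (\<lambda>x. inverse (f x))) n" for v
  proof (subst higher_differentiable_on_cong[OF assms(1)])
    \<comment> \<open>The minus sign is written as a constant factor, so that the rule for products
      covers it.\<close>
    show "higher_differentiable_on S
        (\<lambda>x. (-1) * (inverse (f x) * dir_deriv v f x * inverse (f x))) n"
      using Suc higher_differentiable_on_SucD[OF Suc.prems]
      by (intro higher_differentiable_on_mult assms(1) Suc.IH higher_differentiable_on_const) auto
    show "dir_deriv v (\<lambda>x. inverse (f x)) x
        = (-1) * (inverse (f x) * dir_deriv v f x * inverse (f x))"
      if "x \<in> S" for x
      by (simp add: dir_derivI[OF der[OF that]])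
  qed
  then show ?case using der by (auto simp: differentiable_def)
qed

text \<open>An affine inner map has the constant derivative \<open>L\<close>, so differentiating
  gives another composite of the same form. Freezing the time in a family and composing with a
  projection are both of this kind.\<close>

lemma higher_differentiable_on_compose_affine:
  assumes "bounded_linear L" "open T" "\<And>x. x \<in> T \<Longrightarrow> c + L x \<in> S"
    and "higher_differentiable_on S f n"
  shows "higher_differentiable_on T (\<lambda>x. f (c + L x)) n"
  using assms(4)
proof (induction n arbitrary: f)
  case 0
  have "continuous_on T (\<lambda>x. c + L x)"
    by (intro continuous_intros linear_continuous_on assms(1))
  with 0 show ?case
    using assms(3) by (auto intro!: continuous_on_compose2[where f = "\<lambda>x. c + L x" and t = S])
next
  case (Suc n)
  have "((\<lambda>x. c + L x) has_derivative L) (at x)" for x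
    using has_derivative_add[OF has_derivative_const bounded_linear_imp_has_derivative[OF assms(1)]]
    by simp
  then have der: "((\<lambda>x. f (c + L x)) has_derivative (\<lambda>v. dir_deriv (L v) f (c + L x))) (at x)"
    if "x \<in> T" for x
    by (rule has_derivative_compose[where f = "\<lambda>x. c + L x" and f' = L])
      (use Suc.prems that assms(3) in \<open>auto intro: has_derivative_dir_deriv\<close>)
  have "higher_differentiable_on T (dir_deriv v (\<lambda>x. f (c + L x))) n" for v
  proof (subst higher_differentiable_on_cong[OF assms(2)])
    show "higher_differentiable_on T (\<lambda>x. dir_deriv (L v) f (c + L x)) n"
      using Suc by auto
    show "dir_deriv v (\<lambda>x. f (c + L x)) x = dir_deriv (L v) f (c + L x)" if "x \<in> T" for x
      by (rule dir_derivI[OF der[OF that]])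
  qed
  then show ?case using der by (auto simp: differentiable_def)
qed

text \<open>When \<open>S\<close> is open, a local extension agrees with \<open>f\<close> on a full
  neighbourhood of each point of \<open>S\<close>.\<close>

lemma smooth_on_open_iff:
  assumes "open S"
  shows "smooth_on S f \<longleftrightarrow> (\<forall>n. higher_differentiable_on S f n)"
proof
  assume f: "smooth_on S f"
  show "\<forall>n. higher_differentiable_on S f n"
  proof (intro allI higher_differentiable_on_local)
    fix n x assume "x \<in> S"
    then obtain W F where W: "open W" "x \<in> W" "\<forall>n. higher_differentiable_on W F n"
      "\<forall>x\<in>W \<inter> S. F x = f x"
      using f unfolding smooth_on_def by meson
    then have "higher_differentiable_on (W \<inter> S) F n"
      using higher_differentiable_on_subset by blast
    then have "higher_differentiable_on (W \<inter> S) f n"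
      using W assms higher_differentiable_on_cong[of "W \<inter> S" F f n] by auto
    then show "\<exists>T. open T \<and> x \<in> T \<and> higher_differentiable_on T f n"
      using W assms \<open>x \<in> S\<close> by blast
  qed
next
  assume "\<forall>n. higher_differentiable_on S f n"
  then show "smooth_on S f" using assms unfolding smooth_on_def by blast
qed

section \<open>Mean value arguments and symmetry of mixed derivatives\<close>

lemma mvt_directional:
  fixes f :: "'a::real_normed_vector \<Rightarrow> real"
  assumes "0 < s" "\<And>r. 0 \<le> r \<Longrightarrow> r \<le> s \<Longrightarrow> f differentiable (at (a + r *\<^sub>R v))"
  obtains r where "0 < r" "r < s" "f (a + s *\<^sub>R v) - f a = s * dir_deriv v f (a + r *\<^sub>R v)"
proof -
  have "((\<lambda>r. f (a + r *\<^sub>R v)) has_real_derivative dir_deriv v f (a + r *\<^sub>R v)) (at r)"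
    if "0 \<le> r" "r \<le> s" for r
  proof -
    let ?D = "frechet_derivative f (at (a + r *\<^sub>R v))"
    have D: "(f has_derivative ?D) (at (a + r *\<^sub>R v))"
      using assms(2)[OF that] by (simp add: frechet_derivative_works)
    have "((\<lambda>r. f (a + r *\<^sub>R v)) has_derivative (\<lambda>h. ?D (h *\<^sub>R v))) (at r)"
      by (rule has_derivative_compose[where f = "\<lambda>r. a + r *\<^sub>R v" and g = f and g' = ?D, OF _ D])
        (auto intro!: derivative_eq_intros)
    moreover have "?D (h *\<^sub>R v) = ?D v * h" for h
      using linear_cmul[OF has_derivative_linear[OF D]] by simp
    ultimately show ?thesis by (simp add: has_field_derivative_def)
  qed
  from MVT2[OF assms(1) this] obtain r where "0 < r" "r < s"
    "f (a + s *\<^sub>R v) - f a = s * dir_deriv v f (a + r *\<^sub>R v)" by auto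
  then show ?thesis using that by blast
qed

text \<open>The mean value theorem is applied twice: in direction \<open>v\<close> to the increment
  of \<open>f\<close> along \<open>w\<close>, then in direction \<open>w\<close> to
  \<open>dir_deriv v f\<close>. The second difference on the left is symmetric in \<open>v\<close>
  and \<open>w\<close>, which is what forces the mixed derivatives to agree.\<close>

lemma second_difference_mvt:
  fixes f :: "'a::real_normed_vector \<Rightarrow> real"
  assumes s: "0 < s" and f: "higher_differentiable_on S f 2"
    and S: "\<And>a b. 0 \<le> a \<Longrightarrow> a \<le> s \<Longrightarrow> 0 \<le> b \<Longrightarrow> b \<le> s \<Longrightarrow> x + a *\<^sub>R v + b *\<^sub>R w \<in> S"
  obtains a b where "0 < a" "a < s" "0 < b" "b < s"
    "f (x + s *\<^sub>R v + s *\<^sub>R w) - f (x + s *\<^sub>R v) - f (x + s *\<^sub>R w) + f x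
      = s * s * dir_deriv w (dir_deriv v f) (x + a *\<^sub>R v + b *\<^sub>R w)"
proof -
  have d1: "f differentiable (at y)" if "y \<in> S" for y
    using f that by (simp add: numeral_2_eq_2)
  have d2: "dir_deriv v f differentiable (at y)" if "y \<in> S" for y
    using f that by (simp add: numeral_2_eq_2)
  let ?h = "\<lambda>y. f (y + s *\<^sub>R w) - f y"
  have hd: "(?h has_derivative (\<lambda>u. dir_deriv u f (y + s *\<^sub>R w) - dir_deriv u f y)) (at y)"
    if "y + s *\<^sub>R w \<in> S" "y \<in> S" for y
  proof -
    have "(f has_derivative (\<lambda>u. dir_deriv u f (y + s *\<^sub>R w))) (at (y + s *\<^sub>R w))"
      "(f has_derivative (\<lambda>u. dir_deriv u f y)) (at y)"
      using d1 that by (auto intro: has_derivative_dir_deriv)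
    note der = this
    have "((\<lambda>y. y + s *\<^sub>R w) has_derivative (\<lambda>u. u)) (at y)"
      by (auto intro!: derivative_eq_intros)
    from has_derivative_diff[OF has_derivative_compose[OF this der(1)] der(2)]
    show ?thesis .
  qed
  have S': "x + r *\<^sub>R v + s *\<^sub>R w \<in> S" "x + r *\<^sub>R v \<in> S" if "0 \<le> r" "r \<le> s" for r
    using S[of r s] S[of r 0] s that by auto
  obtain a where a: "0 < a" "a < s"
    "?h (x + s *\<^sub>R v) - ?h x = s * dir_deriv v ?h (x + a *\<^sub>R v)"
  proof (rule mvt_directional[OF s, of ?h x v])
    show "?h differentiable (at (x + r *\<^sub>R v))" if "0 \<le> r" "r \<le> s" for r
      using hd[OF S'[OF that]] by (auto simp: differentiable_def)
  qed
  obtain b where b: "0 < b" "b < s"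
    "dir_deriv v f (x + a *\<^sub>R v + s *\<^sub>R w) - dir_deriv v f (x + a *\<^sub>R v)
      = s * dir_deriv w (dir_deriv v f) (x + a *\<^sub>R v + b *\<^sub>R w)"
  proof (rule mvt_directional[OF s, of "dir_deriv v f" "x + a *\<^sub>R v" w])
    show "dir_deriv v f differentiable (at (x + a *\<^sub>R v + r *\<^sub>R w))" if "0 \<le> r" "r \<le> s" for r
      using d2 S a that by simp
  qed
  have "dir_deriv v ?h (x + a *\<^sub>R v)
      = dir_deriv v f (x + a *\<^sub>R v + s *\<^sub>R w) - dir_deriv v f (x + a *\<^sub>R v)"
    using S'[of a] a by (intro dir_derivI hd) auto
  then show ?thesis using that[of a b] a b by (auto simp: algebra_simps)
qed

text \<open>One and the same second difference equals \<open>s * s\<close> times either mixed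
  derivative, each at some point near \<open>x\<close>. After cancelling \<open>s * s\<close>,
  continuity of both mixed derivatives at \<open>x\<close> brings their values there within any
  \<open>e\<close> of each other.\<close>

lemma dir_deriv_commute_real:
  fixes f :: "'a::real_normed_vector \<Rightarrow> real"
  assumes "open S" "x \<in> S" and f: "higher_differentiable_on S f 2"
  shows "dir_deriv w (dir_deriv v f) x = dir_deriv v (dir_deriv w f) x"
proof -
  let ?A = "dir_deriv w (dir_deriv v f)" and ?B = "dir_deriv v (dir_deriv w f)"
  have close: "\<bar>?A x - ?B x\<bar> \<le> e" if "e > 0" for e
  proof -
    have "continuous_on S ?A" "continuous_on S ?B"
      using f by (auto simp: numeral_2_eq_2)
    then have "isCont ?A x" "isCont ?B x"
      using assms continuous_on_eq_continuous_at by auto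
    then obtain d1 d2 where d12: "d1 > 0" "d2 > 0"
      "\<And>y. dist y x < d1 \<Longrightarrow> dist (?A y) (?A x) < e / 2"
      "\<And>y. dist y x < d2 \<Longrightarrow> dist (?B y) (?B x) < e / 2"
      unfolding continuous_at_eps_delta using \<open>e > 0\<close> by (metis half_gt_zero)
    obtain d3 where d3: "d3 > 0" "ball x d3 \<subseteq> S"
      using assms open_contains_ball by blast
    define d where "d = min d1 (min d2 d3)"
    have d: "d > 0" using d12 d3 by (simp add: d_def)
    \<comment> \<open>This size keeps the whole parallelogram with sides
      \<open>s *\<^sub>R v\<close> and \<open>s *\<^sub>R w\<close> within \<open>d / 2\<close> of
      \<open>x\<close>; the summand 1 guards against \<open>v = w = 0\<close>.\<close>
    define s where "s = d / (2 * (1 + norm v + norm w))"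
    have half: "d / (2 * m) * m = d / 2" if "m > 0" for m
      using that by simp
    have nn: "1 + norm v + norm w > 0"
      using norm_ge_zero[of v] norm_ge_zero[of w] by linarith
    have s: "s > 0" using d nn by (simp add: s_def)
    have near: "dist (x + a *\<^sub>R v + b *\<^sub>R w) x < d"
      if "0 \<le> a" "a \<le> s" "0 \<le> b" "b \<le> s" for a b
    proof -
      have "dist (x + a *\<^sub>R v + b *\<^sub>R w) x \<le> a * norm v + b * norm w"
        using norm_triangle_ineq[of "a *\<^sub>R v" "b *\<^sub>R w"] that by (simp add: dist_norm)
      also have "\<dots> \<le> s * norm v + s * norm w"
        using that by (intro add_mono mult_right_mono) auto
      also have "\<dots> \<le> s * (1 + norm v + norm w)" using s by (simp add: algebra_simps)
      also have "s * (1 + norm v + norm w) = d / 2"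
        unfolding s_def using half[OF nn] .
      also have "\<dots> < d" using d by simp
      finally show ?thesis .
    qed
    have inS: "x + a *\<^sub>R v + b *\<^sub>R w \<in> S"
      if "0 \<le> a" "a \<le> s" "0 \<le> b" "b \<le> s" for a b
      using near[OF that] d3 by (auto simp: d_def dist_commute subset_iff)
    have inS': "x + b *\<^sub>R w + a *\<^sub>R v \<in> S"
      if "0 \<le> b" "b \<le> s" "0 \<le> a" "a \<le> s" for a b
      using inS[OF that(3,4,1,2)] by (simp add: add_ac)
    obtain a b where ab: "0 < a" "a < s" "0 < b" "b < s"
      "f (x + s *\<^sub>R v + s *\<^sub>R w) - f (x + s *\<^sub>R v) - f (x + s *\<^sub>R w) + f x
        = s * s * ?A (x + a *\<^sub>R v + b *\<^sub>R w)"
      using second_difference_mvt[OF s f inS] by blast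
    obtain b' a' where ab': "0 < a'" "a' < s" "0 < b'" "b' < s"
      "f (x + s *\<^sub>R w + s *\<^sub>R v) - f (x + s *\<^sub>R w) - f (x + s *\<^sub>R v) + f x
        = s * s * ?B (x + b' *\<^sub>R w + a' *\<^sub>R v)"
      using second_difference_mvt[OF s f inS'] by blast
    have "s * s * ?A (x + a *\<^sub>R v + b *\<^sub>R w) = s * s * ?B (x + b' *\<^sub>R w + a' *\<^sub>R v)"
      unfolding ab(5)[symmetric] ab'(5)[symmetric] by (simp add: add_ac)
    then have "?A (x + a *\<^sub>R v + b *\<^sub>R w) = ?B (x + a' *\<^sub>R v + b' *\<^sub>R w)"
      using s by (simp add: add_ac)
    moreover have "dist (?A (x + a *\<^sub>R v + b *\<^sub>R w)) (?A x) < e / 2"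
      using d12(3) near[of a b] ab by (simp add: d_def)
    moreover have "dist (?B (x + a' *\<^sub>R v + b' *\<^sub>R w)) (?B x) < e / 2"
      using d12(4) near[of a' b'] ab' by (simp add: d_def)
    ultimately show ?thesis unfolding dist_real_def by linarith
  qed
  have "\<bar>?A x - ?B x\<bar> \<le> 0" by (rule field_le_epsilon) (use close in simp)
  then show ?thesis by simp
qed

text \<open>Taking inner products with a fixed \<open>c\<close> commutes with differentiation, which
  reduces the claim to real-valued functions.\<close>

lemma dir_deriv_commute:
  fixes f :: "'a::real_normed_vector \<Rightarrow> 'b::real_inner"
  assumes S: "open S" "x \<in> S" and f: "higher_differentiable_on S f 2"
  shows "dir_deriv w (dir_deriv v f) x = dir_deriv v (dir_deriv w f) x"
proof -
  have inner1: "dir_deriv v (\<lambda>x. h x \<bullet> c) y = dir_deriv v h y \<bullet> c"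
    if "h differentiable (at y)" for h :: "'a \<Rightarrow> 'b" and v c y
    by (intro dir_derivI has_derivative_inner_left has_derivative_dir_deriv that)
  have inner2: "dir_deriv w (dir_deriv v (\<lambda>x. f x \<bullet> c)) x = dir_deriv w (dir_deriv v f) x \<bullet> c" for v w c
  proof -
    have "dir_deriv w (dir_deriv v (\<lambda>x. f x \<bullet> c)) x = dir_deriv w (\<lambda>x. dir_deriv v f x \<bullet> c) x"
      using f by (intro dir_deriv_cong[OF S] inner1) (auto simp: numeral_2_eq_2)
    also have "\<dots> = dir_deriv w (dir_deriv v f) x \<bullet> c"
      using f S by (intro inner1) (auto simp: numeral_2_eq_2)
    finally show ?thesis .
  qed
  have "dir_deriv w (dir_deriv v f) x \<bullet> c = dir_deriv v (dir_deriv w f) x \<bullet> c" for c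
    using dir_deriv_commute_real[where v = v and w = w,
        OF S higher_differentiable_on_inner[OF S(1) f higher_differentiable_on_const[where c = c]]]
    by (simp only: inner2)
  then show ?thesis using vector_eq_rdot by blast
qed

section \<open>Linearity in the direction, Cauchy-Riemann equations and slices of maps on a
  product\<close>

lemma dir_deriv_add_direction:
  "f differentiable (at x) \<Longrightarrow> dir_deriv (u + v) f x = dir_deriv u f x + dir_deriv v f x"
  by (meson has_derivative_dir_deriv has_derivative_linear linear_add)

lemma dir_deriv_scaleR_direction:
  "f differentiable (at x) \<Longrightarrow> dir_deriv (c *\<^sub>R v) f x = c *\<^sub>R dir_deriv v f x"
  by (meson has_derivative_dir_deriv has_derivative_linear linear_cmul)

lemma dir_deriv_complex_expand:
  assumes "f differentiable (at (z::complex))"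
  shows "dir_deriv v f z = Re v *\<^sub>R dir_deriv 1 f z + Im v *\<^sub>R dir_deriv \<i> f z"
proof -
  have "v = Re v *\<^sub>R 1 + Im v *\<^sub>R \<i>" by (simp add: complex_eq_iff)
  then show ?thesis
    using dir_deriv_add_direction[OF assms] dir_deriv_scaleR_direction[OF assms] by metis
qed

text \<open>A real-linear map of the plane is multiplication by a complex number exactly when it
  sends \<open>\<i>\<close> to \<open>\<i>\<close> times its value at 1.\<close>

lemma holomorphic_on_iff_dir_deriv:
  assumes "open S" "\<And>z. z \<in> S \<Longrightarrow> f differentiable (at z)"
  shows "f holomorphic_on S \<longleftrightarrow> (\<forall>z\<in>S. dir_deriv \<i> f z = \<i> * dir_deriv 1 f z)"
proof -
  have "f field_differentiable (at z) \<longleftrightarrow> dir_deriv \<i> f z = \<i> * dir_deriv 1 f z" if "z \<in> S" for z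
  proof
    assume "f field_differentiable (at z)"
    then obtain c where "(f has_derivative (*) c) (at z)"
      unfolding field_differentiable_def has_field_derivative_def by blast
    then have "dir_deriv v f z = c * v" for v by (rule dir_derivI)
    then show "dir_deriv \<i> f z = \<i> * dir_deriv 1 f z" by simp
  next
    assume *: "dir_deriv \<i> f z = \<i> * dir_deriv 1 f z"
    have "dir_deriv v f z = dir_deriv 1 f z * v" for v
      unfolding dir_deriv_complex_expand[OF assms(2)[OF that], of v] *
      by (simp add: complex_eq_iff algebra_simps)
    then have "(\<lambda>v. dir_deriv v f z) = (*) (dir_deriv 1 f z)" by (rule ext)
    then show "f field_differentiable (at z)"
      using has_derivative_dir_deriv[OF assms(2)[OF that]]
      unfolding field_differentiable_def has_field_derivative_def by metis
  qed
  then show ?thesis by (simp add: holomorphic_on_open[OF assms(1)] field_differentiable_def)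
qed

text \<open>Space derivatives at a fixed time become directional derivatives on the product, where
  they can be interchanged with the time derivative.\<close>

lemma dir_deriv_slice:
  assumes "F differentiable (at (t, y))"
  shows "dir_deriv v (\<lambda>y. F (t, y)) y = dir_deriv (0, v) F (t, y)"
  by (rule dir_derivI, rule has_derivative_compose[where f = "Pair t", OF _ has_derivative_dir_deriv[OF assms]])
    (auto intro!: derivative_eq_intros)

lemma has_vector_derivative_time_slice:
  fixes F :: "real \<times> 'a::real_normed_vector \<Rightarrow> 'b::real_normed_vector"
  assumes "F differentiable (at (t, y))"
  shows "((\<lambda>t. F (t, y)) has_vector_derivative dir_deriv (1, 0) F (t, y)) (at t)"
proof -
  have "((\<lambda>t. F (t, y)) has_derivative (\<lambda>s. dir_deriv (s, 0) F (t, y))) (at t)"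
    by (rule has_derivative_compose[where f = "\<lambda>t. (t, y)", OF _ has_derivative_dir_deriv[OF assms]])
      (auto intro!: derivative_eq_intros)
  moreover have "(\<lambda>s. dir_deriv (s, 0) F (t, y)) = (\<lambda>s. s *\<^sub>R dir_deriv (1, 0) F (t, y))"
  proof
    show "dir_deriv (s, 0) F (t, y) = s *\<^sub>R dir_deriv (1, 0) F (t, y)" for s
      using dir_deriv_scaleR_direction[OF assms, of s "(1, 0)"] by simp
  qed
  ultimately show ?thesis unfolding has_vector_derivative_def by (simp only:)
qed

section \<open>First variation of the tension field\<close>

locale conformal_metric =
  fixes M :: "complex set" and g :: metric and \<rho> :: "complex \<Rightarrow> real"
  assumes open_M: "open M"
    and conformal: "g x u v = \<rho> x * (u \<bullet> v)"
    and positive: "x \<in> M \<Longrightarrow> \<rho> x > 0"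
    and smooth: "higher_differentiable_on M \<rho> n"
begin

section \<open>Levi-Civita connection and tension field of a conformal metric\<close>

lemma differentiable_factor: "z \<in> M \<Longrightarrow> \<rho> differentiable (at z)"
  using smooth[of 1] by simp

text \<open>In complex notation this is \<open>\<partial>\<^sub>z log \<rho>\<close>, where \<open>\<partial>\<^sub>z = (\<partial>\<^sub>x - \<i> \<partial>\<^sub>y) / 2\<close>.\<close>

definition conn :: "complex \<Rightarrow> complex" where
  "conn z = inverse (2 * \<rho> z) *\<^sub>R (dir_deriv 1 \<rho> z *\<^sub>R 1 + dir_deriv \<i> \<rho> z *\<^sub>R (- \<i>))"

lemma conn_mult: "z \<in> M \<Longrightarrow> 2 * \<rho> z *\<^sub>R conn z = dir_deriv 1 \<rho> z *\<^sub>R 1 + dir_deriv \<i> \<rho> z *\<^sub>R (- \<i>)"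
  using positive[of z] by (simp add: conn_def complex_eq_iff)

lemma differentiable_conn: "z \<in> M \<Longrightarrow> conn differentiable (at z)"
proof -
  have "\<rho> x \<noteq> 0" if "x \<in> M" for x using positive[OF that] by simp
  then have "higher_differentiable_on M conn 1"
    unfolding conn_def using smooth[of 1] smooth[of 2]
    by (intro higher_differentiable_on_scaleR higher_differentiable_on_inverse
        higher_differentiable_on_add higher_differentiable_on_mult open_M
        higher_differentiable_on_const) (auto simp: numeral_2_eq_2)
  then show "z \<in> M \<Longrightarrow> conn differentiable (at z)" by simp
qed

lemma dir_deriv_factor:
  assumes "z \<in> M"
  shows "dir_deriv u \<rho> z = 2 * \<rho> z * Re (conn z * u)"
  unfolding dir_deriv_complex_expand[OF differentiable_factor[OF assms], of u]
  using positive[OF assms] by (simp add: conn_def field_simps)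

lemma dir_deriv_metric:
  assumes "z \<in> M"
  shows "dir_deriv u (\<lambda>x. g x v w) z = dir_deriv u \<rho> z * (v \<bullet> w)"
  unfolding conformal
  by (intro dir_derivI has_derivative_mult_left has_derivative_dir_deriv differentiable_factor assms)

text \<open>Uniqueness of the connection leaves only a verification. With
  \<open>a = conn z * u\<close>, compatibility is the identity \<open>(a * v) \<bullet> w + v
  \<bullet> (a * w) = 2 * Re a * (v \<bullet> w)\<close> combined with
  \<open>dir_deriv_factor\<close>.\<close>

lemma christoffel_eq:
  assumes "z \<in> M"
  shows "christoffel g z = (\<lambda>u v. conn z * (u * v))"
  unfolding christoffel_def
proof (rule the1_equality)
  show "\<exists>!\<Gamma>. is_levi_civita g z \<Gamma>"
    by (rule ex1_levi_civita_conformal[OF conformal differentiable_factor positive]) (use assms in auto)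
  have "bilinear (\<lambda>u v. conn z * (u * v))"
    unfolding bilinear_def by (auto intro!: linearI simp: algebra_simps)
  moreover have "dir_deriv u (\<lambda>x. g x v w) z
      = g z (conn z * (u * v)) w + g z v (conn z * (u * w))" for u v w
    unfolding dir_deriv_metric[OF assms] dir_deriv_factor[OF assms]
    unfolding conformal
    by (simp add: inner_complex_def algebra_simps)
  ultimately show "is_levi_civita g z (\<lambda>u v. conn z * (u * v))"
    unfolding is_levi_civita_def by (simp add: mult.commute)
qed

lemma tension_field_eq:
  assumes V: "open V" "x \<in> V" and x: "x \<in> M" and \<phi>: "higher_differentiable_on V \<phi> 2" "\<phi> x \<in> M"
  shows "tension_field g \<phi> x = (1 / \<rho> x) *\<^sub>R
    (dir_deriv 1 (dir_deriv 1 \<phi>) x + dir_deriv \<i> (dir_deriv \<i> \<phi>) x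
      + conn (\<phi> x) * ((dir_deriv 1 \<phi> x)\<^sup>2 + (dir_deriv \<i> \<phi> x)\<^sup>2))"
proof -
  have d1: "\<phi> differentiable (at y)" if "y \<in> V" for y
    using \<phi> that by (simp add: numeral_2_eq_2)
  have d2: "dir_deriv v \<phi> differentiable (at x)" for v
    using \<phi> V by (simp add: numeral_2_eq_2)
  note lin = dir_deriv_add_direction[OF d1[OF V(2)]] dir_deriv_scaleR_direction[OF d1[OF V(2)]]
    dir_deriv_add_direction[OF d2] dir_deriv_scaleR_direction[OF d2]
  have add2: "dir_deriv u (dir_deriv (v + w) \<phi>) x
      = dir_deriv u (dir_deriv v \<phi>) x + dir_deriv u (dir_deriv w \<phi>) x" for u v w
  proof -
    have "dir_deriv u (dir_deriv (v + w) \<phi>) x = dir_deriv u (\<lambda>y. dir_deriv v \<phi> y + dir_deriv w \<phi> y) x"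
      by (rule dir_deriv_cong[OF V]) (rule dir_deriv_add_direction[OF d1])
    also have "\<dots> = dir_deriv u (dir_deriv v \<phi>) x + dir_deriv u (dir_deriv w \<phi>) x"
      by (intro dir_derivI has_derivative_add has_derivative_dir_deriv d2)
    finally show ?thesis .
  qed
  have scale2: "dir_deriv u (dir_deriv (c *\<^sub>R v) \<phi>) x = c *\<^sub>R dir_deriv u (dir_deriv v \<phi>) x" for u v c
  proof -
    have "dir_deriv u (dir_deriv (c *\<^sub>R v) \<phi>) x = dir_deriv u (\<lambda>y. c *\<^sub>R dir_deriv v \<phi> y) x"
      by (rule dir_deriv_cong[OF V]) (rule dir_deriv_scaleR_direction[OF d1])
    also have "\<dots> = c *\<^sub>R dir_deriv u (dir_deriv v \<phi>) x"
      by (intro dir_derivI has_derivative_scaleR_right has_derivative_dir_deriv d2)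
    finally show ?thesis .
  qed
  let ?B = "nabla_differential g \<phi> x"
  have B: "?B u v = dir_deriv u (dir_deriv v \<phi>) x + conn (\<phi> x) * (dir_deriv u \<phi> x * dir_deriv v \<phi> x)
      - dir_deriv (conn x * (u * v)) \<phi> x" for u v
    unfolding nabla_differential_def pullback_connection_def christoffel_eq[OF x]
      christoffel_eq[OF \<phi>(2)] by simp
  have "bilinear ?B"
    unfolding bilinear_def B
    by (auto intro!: linearI simp: lin add2 scale2 distrib_left distrib_right algebra_simps)
  from metric_trace_conformal[where g = g and r = "\<rho> x", OF conformal positive[OF x] this]
  have "tension_field g \<phi> x = (1 / \<rho> x) *\<^sub>R (?B 1 1 + ?B \<i> \<i>)"
    unfolding tension_field_def .
  \<comment> \<open>The domain connection contributes the derivatives of \<open>\<phi>\<close> along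
    \<open>conn x * (1 * 1)\<close> and \<open>conn x * (\<i> * \<i>)\<close>, which cancel; only
    the connection of the target survives.\<close>
  moreover have "dir_deriv (- conn x) \<phi> x = - dir_deriv (conn x) \<phi> x"
    using lin(2)[of "-1" "conn x"] by simp
  ultimately show ?thesis
    unfolding B by (simp add: power2_eq_square algebra_simps)
qed

text \<open>Up to sign and the factor \<open>1 / \<rho>\<close>, this is the Jacobi operator of the
  identity map.\<close>

definition jacobi :: "(complex \<Rightarrow> complex) \<Rightarrow> complex \<Rightarrow> complex" where
  "jacobi \<xi> x = dir_deriv 1 (dir_deriv 1 \<xi>) x + dir_deriv \<i> (dir_deriv \<i> \<xi>) x
     + 2 * conn x * (dir_deriv 1 \<xi> x + \<i> * dir_deriv \<i> \<xi> x)"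

text \<open>Near \<open>(0, x)\<close> the family extends to a map \<open>F\<close> that is smooth
  for times on both sides of 0. There the time derivative commutes with the space derivatives,
  turning those of \<open>F\<close> into those of \<open>\<xi>\<close>, and the product rule gives
  the rest.\<close>

lemma has_vector_derivative_tension_field:
  assumes \<epsilon>: "\<epsilon> > 0" and smooth_\<phi>: "smooth_on ({0..<\<epsilon>} \<times> M) (\<lambda>(t, x). \<phi> t x)"
    and \<phi>_M: "\<And>t x. t \<in> {0..<\<epsilon>} \<Longrightarrow> x \<in> M \<Longrightarrow> \<phi> t x \<in> M"
    and \<phi>_0: "\<And>x. x \<in> M \<Longrightarrow> \<phi> 0 x = x"
    and \<phi>_\<xi>: "\<And>x. x \<in> M \<Longrightarrow> ((\<lambda>t. \<phi> t x) has_vector_derivative \<xi> x) (at 0 within {0..<\<epsilon>})"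
    and x: "x \<in> M"
  shows "((\<lambda>t. tension_field g (\<phi> t) x) has_vector_derivative (1 / \<rho> x) *\<^sub>R jacobi \<xi> x)
    (at 0 within {0..<\<epsilon>})"
proof -
  have "(0, x) \<in> {0..<\<epsilon>} \<times> M" using \<epsilon> x by simp
  with smooth_\<phi> obtain W F where W: "open W" "(0, x) \<in> W" "\<And>n. higher_differentiable_on W F n"
    and F: "\<And>p. p \<in> W \<inter> ({0..<\<epsilon>} \<times> M) \<Longrightarrow> F p = (case p of (t, x) \<Rightarrow> \<phi> t x)"
    unfolding smooth_on_def by (metis (no_types, lifting))
  obtain A V' where A: "open A" "0 \<in> A" and V': "open V'" "x \<in> V'" "A \<times> V' \<subseteq> W"
    using open_prod_elim[OF W(1,2)] by (metis mem_Sigma_iff)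
  define V where "V = V' \<inter> M"
  have V: "open V" "x \<in> V" "V \<subseteq> M" using V' x open_M by (auto simp: V_def)
  have AV: "(t, y) \<in> W" if "t \<in> A" "y \<in> V" for t y
    using that V' by (auto simp: V_def)
  have F_eq: "\<phi> t y = F (t, y)" if "t \<in> A" "t \<in> {0..<\<epsilon>}" "y \<in> V" for t y
    using F[of "(t, y)"] AV that V by auto
  obtain d where d: "d > 0" "ball 0 d \<subseteq> A" using A open_contains_ball by blast
  let ?D = "\<lambda>v. dir_deriv (0, v) F"
  let ?D2 = "\<lambda>v. dir_deriv (0, v) (?D v)"
  let ?\<tau> = "(1::real, 0::complex)"
  have df: "F differentiable (at p)" "dir_deriv a F differentiable (at p)"
    "dir_deriv b (dir_deriv a F) differentiable (at p)" if "p \<in> W" for p a b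
    using W(3)[of 3] that unfolding numeral_3_eq_3 higher_differentiable_on.simps by blast+
  have hd2: "higher_differentiable_on W (dir_deriv a F) 2" for a
    using W(3)[of 3] unfolding numeral_3_eq_3 numeral_2_eq_2 higher_differentiable_on.simps by blast
  have slice1: "dir_deriv v (\<lambda>y. F (t, y)) y = ?D v (t, y)" if "t \<in> A" "y \<in> V" for t y v
    by (intro dir_deriv_slice df AV that)
  have slice2: "dir_deriv v (dir_deriv v (\<lambda>y. F (t, y))) y = ?D2 v (t, y)" if "t \<in> A" "y \<in> V" for t y v
  proof -
    have "dir_deriv v (dir_deriv v (\<lambda>y. F (t, y))) y = dir_deriv v (\<lambda>y. ?D v (t, y)) y"
      by (rule dir_deriv_cong[OF V(1) that(2)]) (rule slice1[OF that(1)])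
    also have "\<dots> = ?D2 v (t, y)" by (intro dir_deriv_slice df AV that)
    finally show ?thesis .
  qed
  \<comment> \<open>The coordinate formula for the tension is written through \<open>F\<close>, so
    that it can be differentiated two-sidedly at 0; it is identified with the tension field only at
    times in \<open>[0, \<epsilon>)\<close>.\<close>
  define T where "T t = (1 / \<rho> x) *\<^sub>R (?D2 1 (t, x) + ?D2 \<i> (t, x)
      + conn (F (t, x)) * ((?D 1 (t, x))\<^sup>2 + (?D \<i> (t, x))\<^sup>2))" for t
  have T: "T t = tension_field g (\<phi> t) x" if t: "t \<in> A" "t \<in> {0..<\<epsilon>}" for t
  proof -
    have "higher_differentiable_on V (\<lambda>y. F ((t, 0) + (0, y))) 2"
      using AV[OF t(1)]
      by (intro higher_differentiable_on_compose_affine[OF _ V(1) _ W(3)])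
        (auto intro!: bounded_linear_Pair bounded_linear_zero bounded_linear_ident)
    then have hd: "higher_differentiable_on V (\<phi> t) 2"
      using higher_differentiable_on_cong[OF V(1), of "\<phi> t" "\<lambda>y. F (t, y)"] F_eq[OF t] by simp
    have e1: "dir_deriv v (\<phi> t) y = dir_deriv v (\<lambda>y. F (t, y)) y" if "y \<in> V" for v y
      by (rule dir_deriv_cong[OF V(1) that]) (rule F_eq[OF t])
    have e2: "dir_deriv v (dir_deriv v (\<phi> t)) x = dir_deriv v (dir_deriv v (\<lambda>y. F (t, y))) x" for v
      by (rule dir_deriv_cong[OF V(1,2)]) (rule e1)
    show ?thesis
      unfolding T_def tension_field_eq[OF V(1,2) x hd \<phi>_M[OF t(2) x]]
        e2 e1[OF V(2)] slice1[OF t(1) V(2)] slice2[OF t(1) V(2)] F_eq[OF t V(2)] ..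
  qed
  have nontriv: "at 0 within {0..<\<epsilon>} \<noteq> bot"
    using \<epsilon> by (simp add: trivial_limit_within)
  \<comment> \<open>Since \<open>F\<close> is differentiable at time 0, its two-sided time
    derivative is pinned down by the one-sided derivative of the family.\<close>
  have F\<xi>: "dir_deriv ?\<tau> F (0, y) = \<xi> y" if y: "y \<in> V" for y
  proof (rule vector_derivative_unique_within[OF nontriv])
    show "((\<lambda>t. F (t, y)) has_vector_derivative dir_deriv ?\<tau> F (0, y)) (at 0 within {0..<\<epsilon>})"
      by (rule has_vector_derivative_at_within)
        (rule has_vector_derivative_time_slice[OF df(1)[OF AV[OF A(2) y]]])
    show "((\<lambda>t. F (t, y)) has_vector_derivative \<xi> y) (at 0 within {0..<\<epsilon>})"
    proof (rule has_vector_derivative_transform_within[OF \<phi>_\<xi> d(1)])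
      show "y \<in> M" using y V by blast
      show "\<phi> t y = F (t, y)" if "t \<in> {0..<\<epsilon>}" "dist t 0 < d" for t
        using that d y by (intro F_eq) (auto simp: dist_commute)
    qed (use \<epsilon> in simp)
  qed
  have \<xi>1: "dir_deriv v (dir_deriv ?\<tau> F) (0, y) = dir_deriv v' \<xi> y"
    if "v = (0, v')" "y \<in> V" for v v' y
  proof -
    have "dir_deriv v (dir_deriv ?\<tau> F) (0, y) = dir_deriv v' (\<lambda>y. dir_deriv ?\<tau> F (0, y)) y"
      unfolding that(1) by (intro dir_deriv_slice[symmetric] df AV A that)
    also have "\<dots> = dir_deriv v' \<xi> y"
      by (rule dir_deriv_cong[OF V(1) that(2)]) (rule F\<xi>)
    finally show ?thesis .
  qed
  have comm: "dir_deriv a (dir_deriv b F) p = dir_deriv b (dir_deriv a F) p" if "p \<in> W" for a b p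
    by (rule dir_deriv_commute[OF W(1) that W(3)])
  have W0: "(0, x) \<in> W" by (rule W)
  have t1: "dir_deriv ?\<tau> (?D v) (0, x) = dir_deriv v \<xi> x" for v
    using comm[OF W0] \<xi>1[OF refl V(2)] by simp
  \<comment> \<open>The time derivative moves inward past one space derivative at a time; the inner
    exchange holds on all of \<open>W\<close>, so it may be differentiated once more.\<close>
  have t2: "dir_deriv ?\<tau> (?D2 v) (0, x) = dir_deriv v (dir_deriv v \<xi>) x" for v
  proof -
    have "dir_deriv ?\<tau> (?D2 v) (0, x) = dir_deriv (0, v) (dir_deriv ?\<tau> (?D v)) (0, x)"
      by (rule dir_deriv_commute[OF W(1) W0 hd2])
    also have "\<dots> = dir_deriv (0, v) (dir_deriv (0, v) (dir_deriv ?\<tau> F)) (0, x)"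
      by (rule dir_deriv_cong[OF W(1) W0]) (rule comm)
    also have "\<dots> = dir_deriv v (\<lambda>y. dir_deriv (0, v) (dir_deriv ?\<tau> F) (0, y)) x"
      by (intro dir_deriv_slice[symmetric] df W0)
    also have "\<dots> = dir_deriv v (dir_deriv v \<xi>) x"
      by (rule dir_deriv_cong[OF V(1,2)]) (rule \<xi>1[OF refl])
    finally show ?thesis .
  qed
  have D0: "?D v (0, x) = v" for v
  proof -
    have "?D v (0, x) = dir_deriv v (\<lambda>y. F (0, y)) x" by (rule slice1[OF A(2) V(2), symmetric])
    also have "\<dots> = dir_deriv v (\<lambda>y. y) x"
      using F_eq[of 0] A \<epsilon> \<phi>_0 V by (intro dir_deriv_cong[OF V(1,2)]) (metis atLeastLessThan_iff order_refl subsetD)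
    finally show ?thesis by simp
  qed
  have F0: "F (0, x) = x" using F_eq[of 0 x] A \<epsilon> \<phi>_0 V by auto
  note slice = has_vector_derivative_time_slice[OF df(1)[OF W0]]
    has_vector_derivative_time_slice[OF df(2)[OF W0]] has_vector_derivative_time_slice[OF df(3)[OF W0]]
  \<comment> \<open>Existence of this derivative is enough: in the product rule its value is
    multiplied by the sum of squares at time 0, which is \<open>1 + \<i> * \<i> = 0\<close> by
    \<open>D0\<close>.\<close>
  have "\<exists>c. ((\<lambda>t. conn (F (t, x))) has_vector_derivative c) (at 0)"
  proof -
    have "conn differentiable (at (F (0, x)))" using differentiable_conn[OF x] F0 by simp
    moreover have "(\<lambda>t. F (t, x)) differentiable (at 0)"
      using slice(1) unfolding has_vector_derivative_def differentiable_def by blast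
    ultimately have "(\<lambda>t. conn (F (t, x))) differentiable (at 0)"
      using differentiable_chain_at[of "\<lambda>t. F (t, x)" 0 conn] by (simp add: o_def)
    then show ?thesis using vector_derivative_works by blast
  qed
  then obtain c where c: "((\<lambda>t. conn (F (t, x))) has_vector_derivative c) (at 0)" ..
  have sq: "((\<lambda>t. (?D 1 (t, x))\<^sup>2 + (?D \<i> (t, x))\<^sup>2) has_vector_derivative
      2 * (dir_deriv 1 \<xi> x + \<i> * dir_deriv \<i> \<xi> x)) (at 0)"
    unfolding power2_eq_square
    using has_vector_derivative_add[OF has_vector_derivative_mult[OF slice(2) slice(2), of "(0, 1)" "(0, 1)"]
        has_vector_derivative_mult[OF slice(2) slice(2), of "(0, \<i>)" "(0, \<i>)"]]
    by (simp add: D0 t1 algebra_simps)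
  have "(T has_vector_derivative (1 / \<rho> x) *\<^sub>R jacobi \<xi> x) (at 0)"
    using has_vector_derivative_scaleR[OF DERIV_const has_vector_derivative_add[OF
          has_vector_derivative_add[OF slice(3) slice(3)] has_vector_derivative_mult[OF c sq]],
        of "1 / \<rho> x" "(0, 1)" "(0, 1)" "(0, \<i>)" "(0, \<i>)"]
    by (simp add: T_def[abs_def] jacobi_def t2 D0 F0 algebra_simps)
  then have "(T has_vector_derivative (1 / \<rho> x) *\<^sub>R jacobi \<xi> x) (at 0 within {0..<\<epsilon>})"
    by (rule has_vector_derivative_at_within)
  then show ?thesis
  proof (rule has_vector_derivative_transform_within[OF _ d(1)])
    show "T t = tension_field g (\<phi> t) x" if "t \<in> {0..<\<epsilon>}" "dist t 0 < d" for t
      using that d by (intro T) (auto simp: dist_commute)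
  qed (use \<epsilon> in simp)
qed

section \<open>Harmonic fields and holomorphic quadratic differentials\<close>

text \<open>Split the differential of \<open>\<xi>\<close> into complex-linear and antilinear parts.
  The linear part and the derivative of \<open>\<rho>\<close> only contribute multiples of the
  metric. The antilinear part \<open>u \<mapsto> b * cnj u\<close>, with \<open>2 * b\<close> the
  bracketed term, contributes \<open>2 * \<rho> z * Re (cnj b * u * v)\<close>.\<close>

lemma part20_lie_derivative:
  assumes z: "z \<in> M" and \<xi>: "\<xi> differentiable (at z)"
  shows "part20 g (lie_derivative_metric \<xi> g) z
    = \<rho> z *\<^sub>R cnj (dir_deriv 1 \<xi> z + \<i> * dir_deriv \<i> \<xi> z)"
  unfolding part20_def
proof (rule the1_equality)
  let ?h = "lie_derivative_metric \<xi> g"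
  have h: "?h z u v = dir_deriv (\<xi> z) \<rho> z * (u \<bullet> v)
      + \<rho> z * (dir_deriv u \<xi> z \<bullet> v) + \<rho> z * (u \<bullet> dir_deriv v \<xi> z)" for u v
    unfolding lie_derivative_metric_def lie_bracket_def dir_deriv_metric[OF z]
    unfolding conformal by simp
  have B: "bilinear (?h z)"
    unfolding bilinear_def h
    by (auto intro!: linearI simp: dir_deriv_add_direction[OF \<xi>] dir_deriv_scaleR_direction[OF \<xi>]
        inner_add_left inner_add_right algebra_simps)
  have sym: "?h z u v = ?h z v u" for u v
    unfolding h by (simp add: inner_commute)
  show "\<exists>!c. \<forall>u v. trace_free_part g ?h z u v = Re (c * (u * v))"
    by (rule ex1_part20_conformal[where g = g and h = ?h and r = "\<rho> z", OF conformal positive[OF z] B sym])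
  have tr: "metric_trace g z (?h z) = (1 / \<rho> z) *\<^sub>R (?h z 1 1 + ?h z \<i> \<i>)"
    by (rule metric_trace_conformal[where g = g and r = "\<rho> z", OF conformal positive[OF z] B])
  show "\<forall>u v. trace_free_part g ?h z u v
      = Re (\<rho> z *\<^sub>R cnj (dir_deriv 1 \<xi> z + \<i> * dir_deriv \<i> \<xi> z) * (u * v))"
  proof (intro allI)
    fix u v
    show "trace_free_part g ?h z u v
      = Re (\<rho> z *\<^sub>R cnj (dir_deriv 1 \<xi> z + \<i> * dir_deriv \<i> \<xi> z) * (u * v))"
      unfolding trace_free_part_def tr h dir_deriv_complex_expand[OF \<xi>, of u]
        dir_deriv_complex_expand[OF \<xi>, of v]
      unfolding conformal using positive[OF z]
      by (simp add: inner_complex_def field_simps)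
  qed
qed

lemma holomorphic_part20_iff_jacobi:
  assumes \<xi>: "\<And>n. higher_differentiable_on M \<xi> n"
  shows "part20 g (lie_derivative_metric \<xi> g) holomorphic_on M \<longleftrightarrow> (\<forall>z\<in>M. jacobi \<xi> z = 0)"
proof -
  define b where "b z = dir_deriv 1 \<xi> z + \<i> * dir_deriv \<i> \<xi> z" for z
  let ?f = "\<lambda>z. \<rho> z *\<^sub>R cnj (b z)"
  have d1: "\<xi> differentiable (at z)" and d2: "dir_deriv v \<xi> differentiable (at z)" if "z \<in> M" for v z
    using \<xi>[of 2] that by (auto simp: numeral_2_eq_2)
  have db: "(b has_derivative
      (\<lambda>v. dir_deriv v (dir_deriv 1 \<xi>) z + \<i> * dir_deriv v (dir_deriv \<i> \<xi>) z)) (at z)"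
    if "z \<in> M" for z
    unfolding b_def[abs_def]
    by (intro has_derivative_add has_derivative_mult_right has_derivative_dir_deriv d2 that)
  have df: "(?f has_derivative (\<lambda>v. \<rho> z *\<^sub>R cnj (dir_deriv v b z) + dir_deriv v \<rho> z *\<^sub>R cnj (b z))) (at z)"
    if "z \<in> M" for z
    using db[OF that]
    by (intro has_derivative_scaleR has_derivative_cnj has_derivative_dir_deriv
        differentiable_factor that) (auto simp: differentiable_def)
  have "part20 g (lie_derivative_metric \<xi> g) holomorphic_on M \<longleftrightarrow> ?f holomorphic_on M"
    using part20_lie_derivative d1 by (intro holomorphic_cong) (auto simp: b_def)
  also have "\<dots> \<longleftrightarrow> (\<forall>z\<in>M. dir_deriv \<i> ?f z = \<i> * dir_deriv 1 ?f z)"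
    using df by (intro holomorphic_on_iff_dir_deriv open_M) (auto simp: differentiable_def)
  also have "\<dots> \<longleftrightarrow> (\<forall>z\<in>M. jacobi \<xi> z = 0)"
  proof (rule ball_cong[OF refl])
    fix z assume z: "z \<in> M"
    have comm: "dir_deriv \<i> (dir_deriv 1 \<xi>) z = dir_deriv 1 (dir_deriv \<i> \<xi>) z"
      by (rule dir_deriv_commute[OF open_M z \<xi>])
    \<comment> \<open>In the product rule the derivatives of \<open>\<rho>\<close> combine to
      \<open>dir_deriv 1 \<rho> z - \<i> * dir_deriv \<i> \<rho> z\<close>, which
      \<open>conn_mult\<close> turns into the connection term.\<close>
    have "dir_deriv \<i> ?f z - \<i> * dir_deriv 1 ?f z
        = \<i> * cnj ((2 * \<rho> z *\<^sub>R conn z) * b z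
          + \<rho> z *\<^sub>R (dir_deriv 1 b z - \<i> * dir_deriv \<i> b z)) * (- 1)"
      unfolding dir_derivI[OF df[OF z]] conn_mult[OF z]
      by (simp add: complex_eq_iff algebra_simps)
    \<comment> \<open>The mixed second derivatives cancel by \<open>comm\<close>, leaving the
      Laplacian.\<close>
    also have "dir_deriv 1 b z - \<i> * dir_deriv \<i> b z
        = dir_deriv 1 (dir_deriv 1 \<xi>) z + dir_deriv \<i> (dir_deriv \<i> \<xi>) z"
      unfolding dir_derivI[OF db[OF z]] comm by (simp add: algebra_simps)
    also have "(2 * \<rho> z *\<^sub>R conn z) * b z
          + \<rho> z *\<^sub>R (dir_deriv 1 (dir_deriv 1 \<xi>) z + dir_deriv \<i> (dir_deriv \<i> \<xi>) z)
        = \<rho> z *\<^sub>R jacobi \<xi> z"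
      by (simp add: jacobi_def b_def complex_eq_iff algebra_simps)
    finally have diff: "dir_deriv \<i> ?f z - \<i> * dir_deriv 1 ?f z = \<i> * cnj (\<rho> z *\<^sub>R jacobi \<xi> z) * (- 1)" .
    show "dir_deriv \<i> ?f z = \<i> * dir_deriv 1 ?f z \<longleftrightarrow> jacobi \<xi> z = 0"
      unfolding eq_iff_diff_eq_0[of "dir_deriv \<i> ?f z"] diff
      using positive[OF z] by simp
  qed
  finally show ?thesis .
qed

text \<open>The first variation of the tension depends only on \<open>\<xi>\<close>, not on the
  family realising it, and one-sided derivatives are unique.\<close>

lemma harmonic_imp_jacobi_zero:
  assumes "harmonic_vector_field M g M \<xi>" "x \<in> M"
  shows "jacobi \<xi> x = 0"
proof -
  from assms(1) obtain \<epsilon> \<phi> where \<epsilon>: "\<epsilon> > 0"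
    and \<phi>: "smooth_on ({0..<\<epsilon>} \<times> M) (\<lambda>(t, x). \<phi> t x)"
      "\<And>t x. t \<in> {0..<\<epsilon>} \<Longrightarrow> x \<in> M \<Longrightarrow> \<phi> t x \<in> M"
      "\<And>x. x \<in> M \<Longrightarrow> \<phi> 0 x = x"
      "\<And>x. x \<in> M \<Longrightarrow> ((\<lambda>t. \<phi> t x) has_vector_derivative \<xi> x) (at 0 within {0..<\<epsilon>})"
    and \<tau>: "((\<lambda>t. tension_field g (\<phi> t) x) has_vector_derivative 0) (at 0 within {0..<\<epsilon>})"
    using assms(2) unfolding harmonic_vector_field_def by blast
  have "at 0 within {0..<\<epsilon>} \<noteq> bot"
    using \<epsilon> by (simp add: trivial_limit_within)
  from vector_derivative_unique_within[OF this
      has_vector_derivative_tension_field[OF \<epsilon> \<phi> assms(2)] \<tau>]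
  show ?thesis using positive[OF assms(2)] by simp
qed

text \<open>
  The straight-line variation \<open>x + t \<xi>(x)\<close> may leave \<open>M\<close>; with \<open>s = t\<^sup>2 g(\<xi>, \<xi>)\<close>, dividing the
  displacement by \<open>1 + s\<close> keeps its squared length \<open>s / (1 + s)\<^sup>2\<close> below \<open>1\<close>.
\<close>

lemma jacobi_zero_imp_harmonic:
  assumes M: "\<And>x v. x \<in> M \<Longrightarrow> g x v v < 1 \<Longrightarrow> x + v \<in> M"
    and \<xi>: "\<And>n. higher_differentiable_on M \<xi> n"
    and J: "\<And>x. x \<in> M \<Longrightarrow> jacobi \<xi> x = 0"
  shows "harmonic_vector_field M g M \<xi>"
proof -
  define N where "N x = \<rho> x * (\<xi> x \<bullet> \<xi> x)" for x
  \<comment> \<open>A reparametrised time: it vanishes at \<open>t = 0\<close> with derivative 1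
    there, so the initial velocity is still \<open>\<xi>\<close>.\<close>
  define q where "q t x = t * inverse (1 + t * t * N x)" for t x
  define \<phi> where "\<phi> t x = x + q t x *\<^sub>R \<xi> x" for t x
  have N: "N x \<ge> 0" if "x \<in> M" for x
    using positive[OF that] by (simp add: N_def)
  have pos: "1 + t * t * N x > 0" if "x \<in> M" for t x
  proof -
    have "0 \<le> t * t * N x" using N[OF that] by simp
    then show ?thesis by linarith
  qed
  let ?U = "UNIV \<times> M :: (real \<times> complex) set"
  have U: "open ?U" by (intro open_Times open_UNIV open_M)
  have snd: "higher_differentiable_on ?U (\<lambda>p. f (snd p)) n"
    if "higher_differentiable_on M f n" for f :: "complex \<Rightarrow> 'b::real_normed_vector" and n
    using higher_differentiable_on_compose_affine[OF bounded_linear_snd U, of 0 M f n] that by auto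
  have N_smooth: "higher_differentiable_on M N n" for n
    unfolding N_def[abs_def]
    by (intro higher_differentiable_on_mult higher_differentiable_on_inner open_M smooth \<xi>)
  have "higher_differentiable_on ?U (\<lambda>p. snd p + (fst p * inverse (1 + fst p * fst p * N (snd p))) *\<^sub>R \<xi> (snd p)) n" for n
    using pos[THEN less_imp_neq]
    by (intro higher_differentiable_on_add higher_differentiable_on_scaleR
        higher_differentiable_on_mult higher_differentiable_on_inverse U
        higher_differentiable_on_const snd[OF N_smooth] snd[OF \<xi>]
        higher_differentiable_on_bounded_linear bounded_linear_fst bounded_linear_snd)
      force
  then have "higher_differentiable_on ?U (\<lambda>(t, x). \<phi> t x) n" for n
    by (simp add: \<phi>_def q_def case_prod_unfold)
  \<comment> \<open>The formula is smooth for all real times, so it serves as its own extension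
    beyond the interval.\<close>
  then have smooth_\<phi>: "smooth_on ({0..<1} \<times> M) (\<lambda>(t, x). \<phi> t x)"
    using U unfolding smooth_on_def by blast
  have \<phi>_M: "\<phi> t x \<in> M" if x: "x \<in> M" for t x
    unfolding \<phi>_def
  proof (rule M[OF x])
    define s where "s = t * t * N x"
    have s: "s \<ge> 0" using N[OF x] by (simp add: s_def)
    have "g x (q t x *\<^sub>R \<xi> x) (q t x *\<^sub>R \<xi> x) = q t x * q t x * N x"
      by (simp add: conformal N_def)
    also have "\<dots> = s / (1 + s)\<^sup>2"
      by (simp add: q_def s_def power2_eq_square divide_inverse mult_ac)
    also have "s < (1 + s)\<^sup>2" using s by (simp add: power2_eq_square algebra_simps add_pos_nonneg)
    then have "s / (1 + s)\<^sup>2 < 1" using s by simp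
    finally show "g x (q t x *\<^sub>R \<xi> x) (q t x *\<^sub>R \<xi> x) < 1" .
  qed
  have \<phi>_\<xi>: "((\<lambda>t. \<phi> t x) has_vector_derivative \<xi> x) (at 0 within {0..<1})" for x
  proof -
    have "((\<lambda>t. q t x) has_real_derivative 1) (at 0 within {0..<1})"
      unfolding q_def by (auto intro!: derivative_eq_intros)
    from has_vector_derivative_scaleR[OF this has_vector_derivative_const]
    have "((\<lambda>t. q t x *\<^sub>R \<xi> x) has_vector_derivative \<xi> x) (at 0 within {0..<1})" by simp
    from has_vector_derivative_add[OF has_vector_derivative_const this]
    show ?thesis unfolding \<phi>_def by simp
  qed
  have \<phi>_0: "\<phi> 0 x = x" for x by (simp add: \<phi>_def q_def)
  have "((\<lambda>t. tension_field g (\<phi> t) x) has_vector_derivative 0) (at 0 within {0..<1})" if "x \<in> M" for x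
    using has_vector_derivative_tension_field[OF zero_less_one smooth_\<phi> \<phi>_M \<phi>_0 \<phi>_\<xi> that] J[OF that]
    by simp
  moreover have "smooth_on M \<xi>" using \<xi> open_M smooth_on_open_iff by blast
  ultimately show ?thesis
    unfolding harmonic_vector_field_def
    using open_M smooth_\<phi> \<phi>_M \<phi>_0 \<phi>_\<xi> zero_less_one by blast
qed

text \<open>Both sides amount to the vanishing of \<open>jacobi \<xi>\<close> on \<open>M\<close>;
  the first hypothesis gives the variation in the converse direction room to stay inside
  \<open>M\<close>.\<close>

lemma harmonic_iff_holomorphic:
  assumes M: "\<And>x v. x \<in> M \<Longrightarrow> g x v v < 1 \<Longrightarrow> x + v \<in> M"
    and \<xi>: "smooth_on M \<xi>"
  shows "harmonic_vector_field M g M \<xi> \<longleftrightarrow>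
    part20 g (lie_derivative_metric \<xi> g) holomorphic_on M"
proof -
  have \<xi>': "higher_differentiable_on M \<xi> n" for n
    using \<xi> smooth_on_open_iff[OF open_M] by blast
  show ?thesis
    using harmonic_imp_jacobi_zero jacobi_zero_imp_harmonic[OF M \<xi>'] holomorphic_part20_iff_jacobi[OF \<xi>']
    by blast
qed

end

section \<open>The half plane and the disk\<close>

interpretation half_plane: conformal_metric upper_half_plane upper_half_plane_metric
  "\<lambda>z. inverse (Im z * Im z)"
proof
  show op: "open upper_half_plane"
    unfolding upper_half_plane_def by (rule open_halfspace_Im_gt)
  show "upper_half_plane_metric x u v = inverse (Im x * Im x) * (u \<bullet> v)" for x u v
    by (simp add: upper_half_plane_metric_def power2_eq_square divide_inverse)
  show "inverse (Im x * Im x) > 0" if "x \<in> upper_half_plane" for x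
    using that by (simp add: upper_half_plane_def)
  show "higher_differentiable_on upper_half_plane (\<lambda>z. inverse (Im z * Im z)) n" for n
    by (intro higher_differentiable_on_inverse higher_differentiable_on_mult
        higher_differentiable_on_bounded_linear bounded_linear_Im op)
      (auto simp: upper_half_plane_def)
qed

text \<open>Metric length below 1 means that \<open>cmod v\<close> is smaller than
  \<open>Im x\<close>, the Euclidean distance from \<open>x\<close> to the boundary.\<close>

lemma upper_half_plane_add:
  assumes "x \<in> upper_half_plane" "upper_half_plane_metric x v v < 1"
  shows "x + v \<in> upper_half_plane"
proof -
  have x: "Im x > 0" using assms(1) by (simp add: upper_half_plane_def)
  have "(cmod v)\<^sup>2 < (Im x)\<^sup>2"
    using assms(2) x by (simp add: upper_half_plane_metric_def power2_norm_eq_inner)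
  then have "cmod v < Im x" by (rule power2_less_imp_less) (use x in simp)
  then show ?thesis
    using abs_Im_le_cmod[of v] by (simp add: upper_half_plane_def)
qed

lemma unit_disk_factor_pos:
  assumes "z \<in> unit_disk"
  shows "1 - (cmod z)\<^sup>2 > 0"
  using assms by (simp add: unit_disk_def power_less_one_iff abs_square_less_1)

text \<open>The factor is spelled with \<open>z \<bullet> z\<close>, sums, products and
  \<open>inverse\<close>, the form to which the closure rules for higher differentiability apply
  directly.\<close>

interpretation disk: conformal_metric unit_disk unit_disk_metric
  "\<lambda>z. 4 * inverse ((1 + (- 1) * (z \<bullet> z)) * (1 + (- 1) * (z \<bullet> z)))"
proof
  have "unit_disk = ball 0 1" by (auto simp: unit_disk_def)
  then show op: "open unit_disk" by (rule ssubst) (rule open_ball)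
  have nz: "1 + (- 1) * (z \<bullet> z) > 0" if "z \<in> unit_disk" for z
    using unit_disk_factor_pos[OF that] by (simp add: power2_norm_eq_inner)
  show "unit_disk_metric x u v
      = 4 * inverse ((1 + (- 1) * (x \<bullet> x)) * (1 + (- 1) * (x \<bullet> x))) * (u \<bullet> v)" for x u v
    unfolding unit_disk_metric_def power2_norm_eq_inner
    by (simp add: power2_eq_square divide_inverse)
  show "4 * inverse ((1 + (- 1) * (x \<bullet> x)) * (1 + (- 1) * (x \<bullet> x))) > 0" if "x \<in> unit_disk" for x
    using nz[OF that] by simp
  show "higher_differentiable_on unit_disk
      (\<lambda>z. 4 * inverse ((1 + (- 1) * (z \<bullet> z)) * (1 + (- 1) * (z \<bullet> z)))) n" for n
    using nz
    by (intro higher_differentiable_on_mult higher_differentiable_on_inverse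
        higher_differentiable_on_add higher_differentiable_on_inner higher_differentiable_on_const
        higher_differentiable_on_bounded_linear bounded_linear_ident op) force
qed

lemma unit_disk_add:
  assumes "x \<in> unit_disk" "unit_disk_metric x v v < 1"
  shows "x + v \<in> unit_disk"
proof -
  have pos: "1 - (cmod x)\<^sup>2 > 0" by (rule unit_disk_factor_pos[OF assms(1)])
  have "(2 * cmod v)\<^sup>2 < (1 - (cmod x)\<^sup>2)\<^sup>2"
    using assms(2) pos by (simp add: unit_disk_metric_def power2_norm_eq_inner power_mult_distrib)
  then have "2 * cmod v < 1 - (cmod x)\<^sup>2"
    by (rule power2_less_imp_less) (use pos in simp)
  \<comment> \<open>Expanding the square gives
    \<open>1 - (cmod x)\<^sup>2 \<le> 2 * (1 - cmod x)\<close>, so \<open>cmod v\<close> is below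
    the Euclidean distance from \<open>x\<close> to the circle.\<close>
  moreover have "0 \<le> (1 - cmod x)\<^sup>2" by simp
  ultimately have "cmod x + cmod v < 1"
    by (simp add: power2_diff)
  then show ?thesis
    using norm_triangle_ineq[of x v] by (simp add: unit_disk_def)
qed

theorem proposition1:
  fixes M :: "complex set" and g :: metric and \<xi> :: "complex \<Rightarrow> complex"
  assumes "(M = upper_half_plane \<and> g = upper_half_plane_metric) \<or>
           (M = unit_disk \<and> g = unit_disk_metric)"
    and "smooth_on M \<xi>"
  shows "harmonic_vector_field M g M \<xi> \<longleftrightarrow>
         part20 g (lie_derivative_metric \<xi> g) holomorphic_on M"
  using assms(1)
proof (elim disjE conjE)
  assume "M = upper_half_plane" "g = upper_half_plane_metric"
  with assms(2) show ?thesis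
    by (simp only:) (rule half_plane.harmonic_iff_holomorphic[OF upper_half_plane_add])
next
  assume "M = unit_disk" "g = unit_disk_metric"
  with assms(2) show ?thesis
    by (simp only:) (rule disk.harmonic_iff_holomorphic[OF unit_disk_add])
qed

end
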